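(* Let $\mathcal H$ and $\mathcal G$ be real Hilbert spaces, let $A\colon\mathcal H\to 2^{\mathcal H}$ and $B\colon\mathcal G\to 2^{\mathcal G}$ be maximally monotone, and let $L\colon\mathcal H\to\mathcal G$ be a bounded linear operator. Consider the primal problem: find $x\in\mathcal H$ with $0\in Ax+L^*BLx$, and the dual problem: find $v\in\mathcal G$ with $0\in -LA^{-1}(-L^*v)+B^{-1}v$. Set $Q=(\mathrm{Id}+L^*L)^{-1}$ and assume $\operatorname{zer}(A+L^*BL)\neq\varnothing$. Let $(\lambda_n)_{n\in\mathbb N}$ be a sequence in $\left]0,2\right[$, $(a_n)_{n\in\mathbb N}$ a sequence in $\mathcal H$, $(b_n)_{n\in\mathbb N}$ a sequence in $\mathcal G$, with $\sum_{n}\lambda_n(2-\lambda_n)=+\infty$ and $\sum_n\lambda_n\sqrt{\|a_n\|^2+\|b_n\|^2}<+\infty$. Let $x_0\in\mathcal H$, $v_0\in\mathcal G$, set $y_0=Lx_0$, $u_0=-L^*v_0$, and for every $n\in\mathbb N$: $p_n=J_A(x_n+u_n)+a_n$, $q_n=J_B(y_n+v_n)+b_n$, $r_n=x_n+u_n-p_n$, $s_n=y_n+v_n-q_n$, $t_n=Q(r_n+L^*s_n)$, $w_n=Q(p_n+L^*q_n)$, $x_{n+1}=x_n-\lambda_nt_n$, $y_{n+1}=y_n-\lambda_nLt_n$, $u_{n+1}=u_n+\lambda_n(w_n-p_n)$, $v_{n+1}=v_n+\lambda_n(Lw_n-q_n)$. Then: (i) $x_n-w_n+Q(a_n+L^*b_n)\to0$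 and $y_n-Lw_n+LQ(a_n+L^*b_n)\to0$; (ii) $u_n-r_n+t_n-a_n+Q(a_n+L^*b_n)\to0$ and $v_n-s_n+Lt_n-b_n+LQ(a_n+L^*b_n)\to0$. Moreover, there exist a solution $\overline x$ of the primal problem and a solution $\overline v$ of the dual problem such that (iii) $-L^*\overline v\in A\overline x$ and $\overline v\in BL\overline x$; (iv) $x_n\rightharpoonup\overline x$ and $v_n\rightharpoonup\overline v$ weakly.
   Context: $J_A=(\mathrm{Id}+A)^{-1}$ is the resolvent of $A$; $A^{-1}$ is the set-valued inverse defined via its graph $\{(u,x):u\in Ax\}$; $\operatorname{zer}$ denotes the set of zeros; $\to$ is strong and $\rightharpoonup$ weak convergence. *)

theory Defs
  imports "HOL-Analysis.Analysis"
begin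

text \<open>Set-valued operators on a real inner product space are modelled as functions
  'a => 'a set (A x is the image of x).  Real Hilbert spaces are types of class
  real_inner + complete_space.\<close>

definition monotone_op :: "('a::real_inner \<Rightarrow> 'a set) \<Rightarrow> bool" where
  "monotone_op A \<longleftrightarrow> (\<forall>x y u v. u \<in> A x \<longrightarrow> v \<in> A y \<longrightarrow> 0 \<le> (x - y) \<bullet> (u - v))"

definition maximally_monotone :: "('a::real_inner \<Rightarrow> 'a set) \<Rightarrow> bool" where
  "maximally_monotone A \<longleftrightarrow> monotone_op A \<and>
     (\<forall>B. monotone_op B \<and> (\<forall>x. A x \<subseteq> B x) \<longrightarrow> B = A)"

text \<open>Resolvent J_A = (Id + A)^{-1}: J_A z is the (unique, for maximally monotone A)
  point p with z \<in> p + A p, i.e. z - p \<in> A p.\<close>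
definition resolvent :: "('a::real_inner \<Rightarrow> 'a set) \<Rightarrow> 'a \<Rightarrow> 'a" where
  "resolvent A z = (THE p. z - p \<in> A p)"

definition op_inverse :: "('a \<Rightarrow> 'b set) \<Rightarrow> 'b \<Rightarrow> 'a set" where
  "op_inverse A u = {x. u \<in> A x}"

definition hadjoint :: "('a::real_inner \<Rightarrow> 'b::real_inner) \<Rightarrow> 'b \<Rightarrow> 'a" where
  "hadjoint L = (\<lambda>y. THE z. \<forall>x. L x \<bullet> y = x \<bullet> z)"

definition weak_conv :: "(nat \<Rightarrow> 'a::real_inner) \<Rightarrow> 'a \<Rightarrow> bool" where
  "weak_conv x l \<longleftrightarrow> (\<forall>z. (\<lambda>n. x n \<bullet> z) \<longlonglongrightarrow> l \<bullet> z)"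

definition primal_sol :: "('a::real_inner \<Rightarrow> 'a set) \<Rightarrow> ('b::real_inner \<Rightarrow> 'b set) \<Rightarrow> ('a \<Rightarrow> 'b) \<Rightarrow> 'a \<Rightarrow> bool" where
  "primal_sol A B L x \<longleftrightarrow> (\<exists>a b. a \<in> A x \<and> b \<in> B (L x) \<and> a + hadjoint L b = 0)"

definition dual_sol :: "('a::real_inner \<Rightarrow> 'a set) \<Rightarrow> ('b::real_inner \<Rightarrow> 'b set) \<Rightarrow> ('a \<Rightarrow> 'b) \<Rightarrow> 'b \<Rightarrow> bool" where
  "dual_sol A B L v \<longleftrightarrow> (\<exists>z w. z \<in> op_inverse A (- hadjoint L v) \<and> w \<in> op_inverse B v \<and> - L z + w = 0)"

definition Qop :: "('a::real_inner \<Rightarrow> 'b::real_inner) \<Rightarrow> 'a \<Rightarrow> 'a" where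
  "Qop L z = (THE x. x + hadjoint L (L x) = z)"

end

theory Submission
  imports Defs
begin

text \<open>Put \<open>K = H \<times> G\<close>, let \<open>V\<close> be the graph of \<open>L\<close> and \<open>P\<close> the projection onto \<open>V\<close>, which is
  \<open>(x, y) \<mapsto> (w, L w)\<close> with \<open>w = Q (x + L\<^sup>* y)\<close>; the orthogonal complement of \<open>V\<close> consists of
  the points \<open>(- L\<^sup>* v, v)\<close>.  Since \<open>(x\<^sub>n, y\<^sub>n) \<in> V\<close> and \<open>(u\<^sub>n, v\<^sub>n)\<close> is orthogonal to \<open>V\<close>, the iteration is
  governed by \<open>z\<^sub>n = (x\<^sub>n + u\<^sub>n, y\<^sub>n + v\<^sub>n)\<close>, and with \<open>J = J\<^sub>A \<times> J\<^sub>B\<close> and the nonexpansive operator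
  \<open>N = (2 P - Id) (2 J - Id)\<close> it reads
  \<open>z\<^sub>n\<^sub>+\<^sub>1 = z\<^sub>n + (\<lambda>\<^sub>n / 2) (N z\<^sub>n - z\<^sub>n) + \<lambda>\<^sub>n (2 P - Id) (a\<^sub>n, b\<^sub>n)\<close>,
  a Krasnoselskii--Mann iteration with summable errors.  Its fixed points are the
  \<open>(x - L\<^sup>* v, L x + v)\<close> with \<open>- L\<^sup>* v \<in> A x\<close> and \<open>v \<in> B (L x)\<close>, and the four strong limits are the
  components of \<open>P (N z\<^sub>n - z\<^sub>n) \<rightarrow> 0\<close> and \<open>(Id - P) (N z\<^sub>n - z\<^sub>n) \<rightarrow> 0\<close>, up to a factor.\<close>

section \<open>Riesz representation and weak compactness\<close>

text \<open>With \<open>L = 0\<close> this yields adjoints, and with general \<open>L\<close> the invertibility of \<open>Id + L\<^sup>* L\<close>.\<close>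

lemma riesz_graph_inner:
  fixes L :: "'a::{real_inner,complete_space} \<Rightarrow> 'b::real_inner" and \<phi> :: "'a \<Rightarrow> real"
  assumes L: "bounded_linear L" and \<phi>: "bounded_linear \<phi>"
  shows "\<exists>x. \<forall>h. x \<bullet> h + L x \<bullet> L h = \<phi> h"
proof -
  interpret L: bounded_linear L by (rule L)
  interpret \<phi>: bounded_linear \<phi> by (rule \<phi>)
  \<comment> \<open>The wanted identity is the Euler equation of this quadratic functional, so its
    minimiser is the required point.\<close>
  define f where "f x = x \<bullet> x + L x \<bullet> L x - 2 * \<phi> x" for x
  obtain K where K: "\<And>x. norm (\<phi> x) \<le> norm x * K"
    using \<phi>.bounded by blast
  have lower: "- K\<^sup>2 \<le> f x" for x
  proof -
    have "\<phi> x \<le> norm x * K" using K[of x] by simp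
    moreover have "0 \<le> (norm x - K)\<^sup>2" "0 \<le> (norm (L x))\<^sup>2" by simp_all
    ultimately show ?thesis
      unfolding f_def power2_diff dot_square_norm by argo
  qed
  define m where "m = (INF x. f x)"
  have bdd: "bdd_below (range f)"
    using lower by (auto intro!: bdd_belowI)
  have m: "m \<le> f x" for x
    unfolding m_def by (rule cINF_lower[OF bdd]) simp
  \<comment> \<open>Parallelogram law for the inner product
    \<open>x \<bullet> y + L x \<bullet> L y\<close>: near-minimisers are close together, so every
    minimising sequence is Cauchy.\<close>
  have par: "(norm (x - y))\<^sup>2 \<le> 2 * (f x - m) + 2 * (f y - m)" for x y
  proof -
    have "(norm (x - y))\<^sup>2 + (norm (L x - L y))\<^sup>2
        = 2 * f x + 2 * f y - 4 * f ((1/2) *\<^sub>R (x + y))"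
      unfolding f_def power2_norm_eq_inner
      by (simp add: L.add L.scaleR \<phi>.add \<phi>.scaleR algebra_simps inner_commute)
    moreover have "0 \<le> (norm (L x - L y))\<^sup>2" by simp
    ultimately show ?thesis using m[of "(1/2) *\<^sub>R (x + y)"] by argo
  qed
  have "\<exists>x. f x < m + 1 / real (Suc n)" for n
  proof (rule ccontr)
    assume "\<not> ?thesis"
    then have "m + 1 / real (Suc n) \<le> m"
      unfolding m_def by (intro cINF_greatest) (auto simp: not_less)
    then show False by simp
  qed
  then obtain X where X: "\<And>n. f (X n) < m + 1 / real (Suc n)"
    by metis
  have "Cauchy X"
  proof (rule metric_CauchyI)
    fix e :: real assume e: "0 < e"
    obtain N where N: "4 / e\<^sup>2 < real N" using reals_Archimedean2 by blast
    show "\<exists>M. \<forall>m\<ge>M. \<forall>n\<ge>M. dist (X m) (X n) < e"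
    proof (intro exI allI impI)
      fix k l assume kl: "N \<le> k" "N \<le> l"
      have *: "f (X k) - m < 1 / real (Suc N)" if "N \<le> k" for k
      proof -
        have "1 / real (Suc k) \<le> 1 / real (Suc N)"
          using that by (intro divide_left_mono) auto
        then show ?thesis using X[of k] by argo
      qed
      have "(norm (X k - X l))\<^sup>2 < 4 * (1 / real (Suc N))"
        using par[of "X k" "X l"] *[OF kl(1)] *[OF kl(2)] by argo
      also have "\<dots> < e\<^sup>2"
      proof -
        have "4 < real N * e\<^sup>2" using N e by (simp add: pos_divide_less_eq)
        also have "\<dots> \<le> real (Suc N) * e\<^sup>2" by (intro mult_right_mono) auto
        finally show ?thesis by (simp add: pos_divide_less_eq mult.commute)
      qed
      finally show "dist (X k) (X l) < e"
        using e by (simp add: dist_norm power_less_imp_less_base)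
    qed
  qed
  then obtain x where x: "X \<longlonglongrightarrow> x"
    using Cauchy_convergent_iff convergent_def by blast
  have "(\<lambda>n. f (X n)) \<longlonglongrightarrow> f x"
    unfolding f_def by (intro tendsto_intros x L.tendsto \<phi>.tendsto)
  moreover have "(\<lambda>n. m + 1 / real (Suc n)) \<longlonglongrightarrow> m + 0"
    using LIMSEQ_inverse_real_of_nat by (intro tendsto_intros) (simp add: divide_inverse)
  ultimately have fx: "f x \<le> m"
    using X by (intro LIMSEQ_le[of "\<lambda>n. f (X n)" _ "\<lambda>n. m + 1 / real (Suc n)"]) (auto intro: less_imp_le)
  have "x \<bullet> h + L x \<bullet> L h = \<phi> h" for h
  proof -
    define c where "c = x \<bullet> h + L x \<bullet> L h - \<phi> h"
    define d where "d = h \<bullet> h + L h \<bullet> L h"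
    have quad: "0 \<le> 2 * t * c + t\<^sup>2 * d" for t
    proof -
      have "f (x + t *\<^sub>R h) = f x + 2 * t * c + t\<^sup>2 * d"
        unfolding f_def c_def d_def
        by (simp add: L.add L.scaleR \<phi>.add \<phi>.scaleR algebra_simps inner_commute power2_eq_square)
      then show ?thesis using m[of "x + t *\<^sub>R h"] fx by linarith
    qed
    \<comment> \<open>The vertex of the quadratic in \<open>quad\<close> is at
      \<open>- c / d\<close>; replacing \<open>1 / d\<close> by \<open>1 / (d + 1)\<close> avoids
      the case \<open>d = 0\<close> and still forces \<open>c = 0\<close>.\<close>
    define r where "r = 1 / (d + 1)"
    have "0 \<le> d" by (simp add: d_def)
    then have r: "0 < r" "r * d \<le> 1" by (simp_all add: r_def field_simps)
    have "0 \<le> r * (c\<^sup>2 * (r * d - 2))"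
      using quad[of "- r * c"] by (simp add: algebra_simps power2_eq_square)
    then have "0 \<le> c\<^sup>2 * (r * d - 2)"
      using r by (simp add: zero_le_mult_iff)
    also have "\<dots> \<le> c\<^sup>2 * (- 1)"
      using r by (intro mult_left_mono) auto
    finally have "c = 0" by simp
    then show ?thesis by (simp add: c_def)
  qed
  then show ?thesis by blast
qed

lemma riesz_representation:
  fixes \<phi> :: "'a::{real_inner,complete_space} \<Rightarrow> real"
  assumes "bounded_linear \<phi>"
  obtains x where "\<And>h. \<phi> h = x \<bullet> h"
proof -
  obtain x where "\<forall>h. x \<bullet> h + (0::real) \<bullet> 0 = \<phi> h"
    using riesz_graph_inner[OF bounded_linear_zero assms] by blast
  then show thesis
    using that[of x] by simp
qed

section \<open>Adjoints and the operator \<open>Q\<close>\<close>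

lemma inner_hadjoint:
  fixes L :: "'a::{real_inner,complete_space} \<Rightarrow> 'b::real_inner"
  assumes L: "bounded_linear L"
  shows "L x \<bullet> y = x \<bullet> hadjoint L y"
proof -
  obtain z where z: "\<And>x. L x \<bullet> y = z \<bullet> x"
    using riesz_representation[of "\<lambda>x. L x \<bullet> y"]
      bounded_linear_compose[OF bounded_linear_inner_left L] by metis
  have "\<forall>x. L x \<bullet> y = x \<bullet> hadjoint L y"
    unfolding hadjoint_def
  proof (rule theI)
    show "\<forall>x. L x \<bullet> y = x \<bullet> z" by (metis z inner_commute)
    fix z' assume z': "\<forall>x. L x \<bullet> y = x \<bullet> z'"
    then have "(z' - z) \<bullet> (z' - z) = 0"
      using z[of "z' - z"] by (simp add: inner_diff_right inner_commute)
    then show "z' = z" by simp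
  qed
  then show ?thesis by blast
qed

lemma linear_hadjoint:
  fixes L :: "'a::{real_inner,complete_space} \<Rightarrow> 'b::real_inner"
  assumes L: "bounded_linear L"
  shows "linear (hadjoint L)"
proof (rule linearI)
  show "hadjoint L (x + y) = hadjoint L x + hadjoint L y" for x y
    by (rule vector_eq_ldot[THEN iffD1]) (simp add: inner_hadjoint[OF L, symmetric] inner_add_right)
  show "hadjoint L (c *\<^sub>R x) = c *\<^sub>R hadjoint L x" for c x
    by (rule vector_eq_ldot[THEN iffD1]) (simp add: inner_hadjoint[OF L, symmetric])
qed

text \<open>Pairing the difference of the two equations with \<open>x - y\<close> gives a sum of two
  squares equal to 0.\<close>

lemma Qop_unique:
  fixes L :: "'a::{real_inner,complete_space} \<Rightarrow> 'b::real_inner"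
  assumes L: "bounded_linear L" and x: "x + hadjoint L (L x) = z" and y: "y + hadjoint L (L y) = z"
  shows "x = y"
proof -
  interpret L: bounded_linear L by (rule L)
  interpret H: linear "hadjoint L" by (rule linear_hadjoint[OF L])
  have "(x - y) + hadjoint L (L (x - y)) = 0"
    using x y by (simp add: L.diff H.diff algebra_simps)
  then have "0 = (x - y) \<bullet> ((x - y) + hadjoint L (L (x - y)))" by simp
  also have "\<dots> = (x - y) \<bullet> (x - y) + L (x - y) \<bullet> L (x - y)"
    by (simp add: inner_add_right inner_hadjoint[OF L])
  finally have "(x - y) \<bullet> (x - y) = 0"
    by (smt (verit) inner_ge_zero)
  then show ?thesis by simp
qed

text \<open>The graph inner product represents \<open>h \<mapsto> z \<bullet> h\<close>; moving
  \<open>L\<close> across by the adjoint turns this into the equation for \<open>Q\<close>.\<close>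

lemma Qop_eq:
  fixes L :: "'a::{real_inner,complete_space} \<Rightarrow> 'b::real_inner"
  assumes L: "bounded_linear L"
  shows "Qop L z + hadjoint L (L (Qop L z)) = z"
proof -
  obtain x where "\<And>h. x \<bullet> h + L x \<bullet> L h = z \<bullet> h"
    using riesz_graph_inner[OF L bounded_linear_inner_right[of z]] by auto
  then have "\<And>h. h \<bullet> (x + hadjoint L (L x)) = h \<bullet> z"
    by (metis inner_add_right inner_commute inner_hadjoint[OF L])
  then have x: "x + hadjoint L (L x) = z"
    using vector_eq_ldot by blast
  show ?thesis
    unfolding Qop_def
  proof (rule theI)
    show "x + hadjoint L (L x) = z" by (rule x)
    show "y = x" if "y + hadjoint L (L y) = z" for y
      using Qop_unique[OF L that x] .
  qed
qed

section \<open>Weak compactness along filters\<close>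

text \<open>Banach--Alaoglu by way of Tychonoff: the functionals \<open>z i \<bullet> _\<close> lie
  in a product of compact intervals, a pointwise cluster point is again linear and bounded, and
  Riesz turns it into a vector. Filters replace subsequences because Minty's theorem needs the
  result for an uncountable family of constraints.\<close>

lemma bounded_weak_cluster_point:
  fixes z :: "'i \<Rightarrow> 'a::{real_inner,complete_space}"
  assumes F: "F \<noteq> bot" and bounded: "\<forall>\<^sub>F i in F. norm (z i) \<le> C"
  obtains G \<xi> where "G \<noteq> bot" "G \<le> F" "\<And>h. ((\<lambda>i. z i \<bullet> h) \<longlongrightarrow> \<xi> \<bullet> h) G"
proof -
  define f where "f i = (\<lambda>h. z i \<bullet> h)" for i
  define K where "K = PiE UNIV (\<lambda>h::'a. {- (C * norm h)..C * norm h})"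
  have "compactin (product_topology (\<lambda>i. euclidean) UNIV) K"
    unfolding K_def compactin_PiE by simp
  then have K: "compact K"
    by (simp add: euclidean_product_topology)
  have "\<forall>\<^sub>F i in F. f i \<in> K"
    using bounded
  proof eventually_elim
    case (elim i)
    have "\<bar>z i \<bullet> h\<bar> \<le> C * norm h" for h
      using Cauchy_Schwarz_ineq2[of "z i" h] mult_right_mono[OF elim norm_ge_zero[of h]] by linarith
    then show ?case
      by (auto simp: K_def f_def abs_le_iff minus_le_iff)
  qed
  then have "eventually (\<lambda>\<phi>. \<phi> \<in> K) (filtermap f F)"
    by (simp add: eventually_filtermap)
  moreover have "filtermap f F \<noteq> bot"
    using F by (simp add: filtermap_bot_iff)
  ultimately obtain \<phi> where \<phi>: "\<phi> \<in> K" "inf (nhds \<phi>) (filtermap f F) \<noteq> bot"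
    using K unfolding compact_filter by blast
  \<comment> \<open>\<open>G\<close> plays the role of a subnet: the coarsest refinement of
    \<open>F\<close> along which \<open>f\<close> tends to \<open>\<phi>\<close>. It is proper
    because \<open>\<phi>\<close> is a cluster point.\<close>
  define G where "G = inf F (filtercomap f (nhds \<phi>))"
  have "G \<noteq> bot"
  proof
    assume "G = bot"
    then have "eventually (\<lambda>_. False) G" by simp
    then obtain P Q where P: "eventually P F" and Q: "eventually Q (nhds \<phi>)"
      and PQ: "\<And>i. P i \<Longrightarrow> Q (f i) \<Longrightarrow> False"
      unfolding G_def eventually_inf eventually_filtercomap by blast
    have "eventually (\<lambda>\<psi>. \<not> Q \<psi>) (filtermap f F)"
      unfolding eventually_filtermap using P by eventually_elim (use PQ in blast)
    with Q have "eventually (\<lambda>_. False) (inf (nhds \<phi>) (filtermap f F))"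
      unfolding eventually_inf by blast
    with \<phi>(2) show False by (simp add: trivial_limit_def)
  qed
  have "G \<le> F" by (simp add: G_def)
  have "filterlim f (nhds \<phi>) G"
    unfolding G_def by (rule filterlim_mono[OF filterlim_filtercomap]) auto
  then have lim: "((\<lambda>i. z i \<bullet> h) \<longlongrightarrow> \<phi> h) G" for h
    using continuous_on_tendsto_compose[OF continuous_on_product_coordinates[of h], of f \<phi> G]
    by (simp add: f_def)
  have "bounded_linear \<phi>"
  proof (rule bounded_linear_intro)
    show "\<phi> (x + y) = \<phi> x + \<phi> y" for x y
      using tendsto_add[OF lim[of x] lim[of y]] lim[of "x + y"] \<open>G \<noteq> bot\<close>
      by (simp add: inner_add_right) (metis tendsto_unique)
    show "\<phi> (r *\<^sub>R x) = r *\<^sub>R \<phi> x" for r x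
      using tendsto_mult_left[OF lim[of x], of r] lim[of "r *\<^sub>R x"] \<open>G \<noteq> bot\<close>
      by simp (metis tendsto_unique)
    show "norm (\<phi> x) \<le> norm x * C" for x
    proof -
      have "\<phi> x \<in> {- (C * norm x)..C * norm x}" using \<phi>(1) by (auto simp: K_def PiE_iff)
      then show ?thesis by (auto simp: abs_le_iff mult.commute)
    qed
  qed
  then obtain \<xi> where "\<And>h. \<phi> h = \<xi> \<bullet> h"
    using riesz_representation by blast
  then show thesis
    using that[OF \<open>G \<noteq> bot\<close> \<open>G \<le> F\<close>, of \<xi>] lim by simp
qed

text \<open>Closed balls are weakly closed: test the convergence against \<open>\<xi> - c\<close>,
  apply Cauchy--Schwarz and cancel one factor \<open>norm (\<xi> - c)\<close>.\<close>

lemma norm_weak_limit_le: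
  fixes \<xi> :: "'a::real_inner"
  assumes "G \<noteq> bot" and lim: "\<And>h. ((\<lambda>i. z i \<bullet> h) \<longlongrightarrow> \<xi> \<bullet> h) G"
    and le: "\<forall>\<^sub>F i in G. norm (z i - c) \<le> r"
  shows "norm (\<xi> - c) \<le> r"
proof (cases "\<xi> = c")
  case True
  obtain i where "norm (z i - c) \<le> r"
    using eventually_happens'[OF \<open>G \<noteq> bot\<close> le] by blast
  then show ?thesis using True order_trans[OF norm_ge_zero] by simp
next
  case False
  have "((\<lambda>i. (z i - c) \<bullet> (\<xi> - c)) \<longlongrightarrow> (\<xi> - c) \<bullet> (\<xi> - c)) G"
    by (subst (1 2) inner_diff_left) (intro tendsto_intros lim)
  moreover have "\<forall>\<^sub>F i in G. (z i - c) \<bullet> (\<xi> - c) \<le> r * norm (\<xi> - c)"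
    using le
  proof eventually_elim
    case (elim i)
    show ?case
      using norm_cauchy_schwarz[of "z i - c" "\<xi> - c"] mult_right_mono[OF elim norm_ge_zero[of "\<xi> - c"]]
      by linarith
  qed
  ultimately have "(\<xi> - c) \<bullet> (\<xi> - c) \<le> r * norm (\<xi> - c)"
    using tendsto_upperbound \<open>G \<noteq> bot\<close> by blast
  then have "norm (\<xi> - c) * norm (\<xi> - c) \<le> r * norm (\<xi> - c)"
    by (simp add: dot_square_norm power2_eq_square)
  then show ?thesis
    using False by (simp add: mult_le_cancel_right)
qed

section \<open>Minty's theorem\<close>

text \<open>The symmetric form \<open>\<beta>\<close> is affine in each argument and, on pairs of
  generators, equals the monotonicity pairing. Nonnegativity thus passes to the hull one argument at
  a time, and on the diagonal it reads \<open>0 \<le> 2 * (d - a \<bullet> a')\<close>.\<close>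

lemma monotone_hull_inner_le:
  fixes S :: "('a::real_inner \<times> 'a) set"
  assumes mono: "\<And>c c' e e'. (c, c') \<in> S \<Longrightarrow> (e, e') \<in> S \<Longrightarrow> 0 \<le> (c - e) \<bullet> (c' - e')"
    and X: "(a, a', d) \<in> convex hull ((\<lambda>(c, c'). (c, c', c \<bullet> c')) ` S)"
  shows "a \<bullet> a' \<le> d"
proof -
  define T where "T = (\<lambda>(c::'a, c'::'a). (c, c', c \<bullet> c')) ` S"
  define \<beta> where "\<beta> = (\<lambda>(c::'a, c'::'a, k::real) (e, e', l). k + l - c \<bullet> e' - e \<bullet> c')"
  have conv: "convex {Y. 0 \<le> \<beta> X Y}" for X
  proof (rule convexI)
    fix Y Z and u v :: real
    assume Y: "Y \<in> {Y. 0 \<le> \<beta> X Y}" and Z: "Z \<in> {Y. 0 \<le> \<beta> X Y}"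
      and uv: "0 \<le> u" "0 \<le> v" "u + v = 1"
    obtain c c' k e e' l f f' m where [simp]: "X = (c, c', k)" "Y = (e, e', l)" "Z = (f, f', m)"
      by (metis prod_cases3)
    have "\<beta> X (u *\<^sub>R Y + v *\<^sub>R Z) = u * \<beta> X Y + v * \<beta> X Z + (1 - (u + v)) * k"
      by (simp add: \<beta>_def inner_add_left inner_add_right algebra_simps)
    then show "u *\<^sub>R Y + v *\<^sub>R Z \<in> {Y. 0 \<le> \<beta> X Y}"
      using uv Y Z by simp
  qed
  have nonneg: "0 \<le> \<beta> X Y" if XY: "X \<in> T" "Y \<in> T" for X Y
  proof -
    obtain c c' e e' where *: "(c, c') \<in> S" "(e, e') \<in> S"
      and [simp]: "X = (c, c', c \<bullet> c')" "Y = (e, e', e \<bullet> e')"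
      using XY unfolding T_def by auto
    show ?thesis
      using mono[OF *] by (simp add: \<beta>_def inner_diff_left inner_diff_right)
  qed
  have "convex hull T \<subseteq> {Y. 0 \<le> \<beta> X Y}" if "X \<in> T" for X
    by (rule hull_minimal[of _ _ convex, OF _ conv]) (use nonneg that in blast)
  moreover have "\<beta> X Y = \<beta> Y X" for X Y
    by (auto simp: \<beta>_def inner_commute split: prod.splits)
  ultimately have "convex hull T \<subseteq> {Y. 0 \<le> \<beta> X Y}" if "X \<in> convex hull T" for X
    using that by (intro hull_minimal conv) (metis (mono_tags, lifting) mem_Collect_eq subset_eq)
  then have "0 \<le> \<beta> (a, a', d) (a, a', d)"
    using X unfolding T_def by blast
  then show ?thesis by (simp add: \<beta>_def)
qed

text \<open>The multipliers of the constraints maximise the concave dual function, that is, minimise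
  \<open>\<parallel>c' - c\<parallel>\<^sup>2 / 4 + d\<close> over the hull of the points \<open>(c, c', c \<bullet> c')\<close>; the first order optimality
  condition at the minimiser says that \<open>p = (c - c') / 2\<close> satisfies all constraints.\<close>

lemma minty_finite:
  fixes S :: "('a::real_inner \<times> 'a) set"
  assumes fin: "finite S"
    and mono: "\<And>c c' e e'. (c, c') \<in> S \<Longrightarrow> (e, e') \<in> S \<Longrightarrow> 0 \<le> (c - e) \<bullet> (c' - e')"
  shows "\<exists>p. \<forall>(c, c') \<in> S. 0 \<le> (p - c) \<bullet> (- p - c')"
proof (cases "S = {}")
  case False
  define T where "T = (\<lambda>(c::'a, c'::'a). (c, c', c \<bullet> c')) ` S"
  define f where "f = (\<lambda>(c::'a, c'::'a, d). (norm (c' - c))\<^sup>2 / 4 + d)"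
  have "compact (convex hull T)"
    unfolding T_def using fin by (intro finite_imp_compact_convex_hull) auto
  moreover have "convex hull T \<noteq> {}"
    using False by (simp add: T_def)
  moreover have "continuous_on (convex hull T) f"
    unfolding f_def case_prod_beta by (intro continuous_intros) auto
  ultimately obtain Y where "Y \<in> convex hull T" "\<And>X. X \<in> convex hull T \<Longrightarrow> f Y \<le> f X"
    using continuous_attains_inf by metis
  then obtain a a' d where Y: "(a, a', d) \<in> convex hull T"
    and min: "\<And>X. X \<in> convex hull T \<Longrightarrow> f (a, a', d) \<le> f X"
    by (metis prod_cases3)
  have le: "a \<bullet> a' \<le> d"
    using monotone_hull_inner_le[OF mono] Y unfolding T_def by blast
  define g where "g = a' - a"
  have "0 \<le> ((-1/2) *\<^sub>R g - c) \<bullet> (- ((-1/2) *\<^sub>R g) - c')" if "(c, c') \<in> S" for c c'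
  proof -
    define k where "k = c' - c - g"
    define e where "e = c \<bullet> c' - d"
    define \<alpha> where "\<alpha> = (g \<bullet> k) / 2 + e"
    have X: "(c, c', c \<bullet> c') \<in> convex hull T"
      using that by (intro hull_inc) (auto simp: T_def)
    \<comment> \<open>Minimality along the segment from the minimiser to a generator;
      \<open>\<alpha>\<close> is the derivative of \<open>f\<close> at its start.\<close>
    have der: "0 \<le> t * \<alpha> + t\<^sup>2 * ((k \<bullet> k) / 4)" if "0 \<le> t" "t \<le> 1" for t
    proof -
      have "(1 - t) *\<^sub>R (a, a', d) + t *\<^sub>R (c, c', c \<bullet> c') \<in> convex hull T"
        using convexD_alt[OF convex_convex_hull Y X] that by blast
      then have "f (a, a', d) \<le> f ((1 - t) *\<^sub>R (a, a', d) + t *\<^sub>R (c, c', c \<bullet> c'))"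
        by (rule min)
      moreover have "(1 - t) *\<^sub>R a' + t *\<^sub>R c' - ((1 - t) *\<^sub>R a + t *\<^sub>R c) = g + t *\<^sub>R k"
        by (simp add: g_def k_def algebra_simps)
      ultimately have "(norm g)\<^sup>2 / 4 + d \<le> (norm (g + t *\<^sub>R k))\<^sup>2 / 4 + (d + t * e)"
        by (simp add: f_def g_def[symmetric] e_def algebra_simps)
      moreover have "(norm (g + t *\<^sub>R k))\<^sup>2 = (norm g)\<^sup>2 + 2 * t * (g \<bullet> k) + t\<^sup>2 * (k \<bullet> k)"
        unfolding power2_norm_eq_inner
        by (simp add: inner_commute algebra_simps power2_eq_square)
      moreover have "t * \<alpha> = t * (g \<bullet> k) / 2 + t * e"
        by (simp add: \<alpha>_def distrib_left)
      ultimately show ?thesis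
        by argo
    qed
    have "0 \<le> \<alpha>"
    proof (rule field_le_epsilon)
      fix \<epsilon> :: real assume "0 < \<epsilon>"
      \<comment> \<open>Small enough to stay on the segment and to push the quadratic term below
        \<open>\<epsilon>\<close>.\<close>
      define t where "t = min 1 (\<epsilon> / (k \<bullet> k + 1))"
      have pos: "0 < k \<bullet> k + 1" using inner_ge_zero[of k] by linarith
      have t: "0 < t" "t \<le> 1" "t \<le> \<epsilon> / (k \<bullet> k + 1)"
        using \<open>0 < \<epsilon>\<close> pos by (auto simp: t_def)
      have "t * (k \<bullet> k + 1) \<le> \<epsilon>"
        using t(3) pos by (simp add: pos_le_divide_eq)
      have "0 \<le> t * (\<alpha> + t * ((k \<bullet> k) / 4))"
        using der[of t] t by (simp add: algebra_simps power2_eq_square)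
      then have "0 \<le> \<alpha> + t * ((k \<bullet> k) / 4)"
        using t by (simp add: zero_le_mult_iff)
      moreover have "t * (k \<bullet> k) \<ge> 0" using t by simp
      ultimately show "0 \<le> \<alpha> + \<epsilon>"
        using t(1) \<open>t * (k \<bullet> k + 1) \<le> \<epsilon>\<close> unfolding distrib_left times_divide_eq_right by argo
    qed
    \<comment> \<open>The constraint at \<open>p\<close> is rewritten as a sum of three nonnegative
      terms: \<open>\<alpha>\<close> by optimality, a square, and \<open>d - a \<bullet> a'\<close>
      by the hull inequality.\<close>
    have "((-1/2) *\<^sub>R g - c) \<bullet> (- ((-1/2) *\<^sub>R g) - c') = (g \<bullet> (c' - c)) / 2 + c \<bullet> c' - (g \<bullet> g) / 4"
      by (simp add: inner_diff_left inner_diff_right inner_add_right inner_commute field_simps)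
    also have "\<dots> = \<alpha> + (g \<bullet> g) / 4 + d"
    proof -
      have "g \<bullet> (c' - c) = g \<bullet> k + g \<bullet> g"
        by (simp add: k_def inner_diff_right)
      then show ?thesis
        unfolding \<alpha>_def e_def by argo
    qed
    also have "\<dots> = \<alpha> + ((norm (a + a'))\<^sup>2) / 4 + (d - a \<bullet> a')"
    proof -
      have "g \<bullet> g = a \<bullet> a - 2 * (a \<bullet> a') + a' \<bullet> a'"
        by (simp add: g_def algebra_simps inner_commute)
      moreover have "(norm (a + a'))\<^sup>2 = a \<bullet> a + 2 * (a \<bullet> a') + a' \<bullet> a'"
        unfolding power2_norm_eq_inner by (simp add: algebra_simps inner_commute)
      ultimately show ?thesis by argo
    qed
    finally show ?thesis using \<open>0 \<le> \<alpha>\<close> le by simp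
  qed
  then show ?thesis by blast
qed simp

text \<open>Each constraint says that \<open>p\<close> lies in the closed ball with centre
  \<open>(c - c') / 2\<close> and radius \<open>norm (c + c') / 2\<close>. Any finitely many of
  these balls meet, and weak compactness yields a common point of all.\<close>

lemma minty_extension:
  fixes S :: "('a::{real_inner,complete_space} \<times> 'a) set"
  assumes mono: "\<And>c c' e e'. (c, c') \<in> S \<Longrightarrow> (e, e') \<in> S \<Longrightarrow> 0 \<le> (c - e) \<bullet> (c' - e')"
  shows "\<exists>p. \<forall>(c, c') \<in> S. 0 \<le> (p - c) \<bullet> (- p - c')"
proof (cases "S = {}")
  case False
  have ball: "0 \<le> (p - c) \<bullet> (- p - c') \<longleftrightarrow> norm (p - (1/2) *\<^sub>R (c - c')) \<le> norm ((1/2) *\<^sub>R (c + c'))"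
    for p c c' :: 'a
  proof -
    have "(norm ((1/2) *\<^sub>R (c + c')))\<^sup>2 - (norm (p - (1/2) *\<^sub>R (c - c')))\<^sup>2 = (p - c) \<bullet> (- p - c')"
      by (simp add: power2_norm_eq_inner algebra_simps inner_commute)
    moreover have "norm (p - (1/2) *\<^sub>R (c - c')) \<le> norm ((1/2) *\<^sub>R (c + c'))
        \<longleftrightarrow> (norm (p - (1/2) *\<^sub>R (c - c')))\<^sup>2 \<le> (norm ((1/2) *\<^sub>R (c + c')))\<^sup>2"
      by (simp add: abs_le_square_iff[symmetric])
    ultimately show ?thesis by linarith
  qed
  define C where "C = (\<lambda>(c, c'). {p::'a. norm (p - (1/2) *\<^sub>R (c - c')) \<le> norm ((1/2) *\<^sub>R (c + c'))})"
  \<comment> \<open>The filter generated by the balls; that it is proper is exactly the finite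
    intersection property.\<close>
  define F where "F = (INF X\<in>S. principal (C X))"
  have "F \<noteq> bot"
    unfolding F_def
  proof (rule INF_filter_not_bot)
    fix X assume X: "X \<subseteq> S" "finite X"
    have "\<exists>p. \<forall>(c, c') \<in> X. 0 \<le> (p - c) \<bullet> (- p - c')"
      using X mono by (intro minty_finite) blast+
    then obtain p where "p \<in> (\<Inter>Y\<in>X. C Y)"
      unfolding C_def ball by fast
    moreover have "(INF Y\<in>X. principal (C Y)) = principal (\<Inter>Y\<in>X. C Y)"
      using X by (simp add: INF_principal_finite)
    ultimately show "(INF Y\<in>X. principal (C Y)) \<noteq> bot"
      by (metis empty_iff principal_eq_bot_iff)
  qed
  have ev: "\<forall>\<^sub>F p in F. p \<in> C X" if "X \<in> S" for X
    unfolding F_def using that by (rule eventually_INF1) (simp add: eventually_principal)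
  obtain c0 c0' where "(c0, c0') \<in> S" using False by auto
  from ev[OF this] have "\<forall>\<^sub>F p in F. norm p \<le> norm ((1/2) *\<^sub>R (c0 - c0')) + norm ((1/2) *\<^sub>R (c0 + c0'))"
    unfolding C_def
  proof eventually_elim
    case (elim p)
    then show ?case
      using norm_triangle_ineq[of "(1/2) *\<^sub>R (c0 - c0')" "p - (1/2) *\<^sub>R (c0 - c0')"] by simp
  qed
  then obtain G \<xi> where G: "G \<noteq> bot" "G \<le> F" "\<And>h. ((\<lambda>p. p \<bullet> h) \<longlongrightarrow> \<xi> \<bullet> h) G"
    using bounded_weak_cluster_point[OF \<open>F \<noteq> bot\<close>, of "\<lambda>p. p"] by metis
  have "0 \<le> (\<xi> - c) \<bullet> (- \<xi> - c')" if "(c, c') \<in> S" for c c'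
    unfolding ball
    by (rule norm_weak_limit_le[OF G(1,3)])
      (use filter_leD[OF G(2) ev[OF that]] in \<open>simp add: C_def\<close>)
  then show ?thesis by blast
qed simp

text \<open>Adding a monotonically related pair to the graph keeps it monotone, so by maximality the
  pair was there already.\<close>

lemma maximally_monotone_mem:
  assumes A: "maximally_monotone A"
    and rel: "\<And>y v. v \<in> A y \<Longrightarrow> 0 \<le> (x - y) \<bullet> (u - v)"
  shows "u \<in> A x"
proof -
  define B where "B = A(x := insert u (A x))"
  have mono: "\<And>x y u v. u \<in> A x \<Longrightarrow> v \<in> A y \<Longrightarrow> 0 \<le> (x - y) \<bullet> (u - v)"
    using A unfolding maximally_monotone_def monotone_op_def by blast
  have rel': "0 \<le> (y - x) \<bullet> (v - u)" if "v \<in> A y" for y v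
    using rel[OF that] by (simp add: inner_diff_left inner_diff_right)
  have "monotone_op B"
    unfolding monotone_op_def B_def using mono rel rel' by (auto split: if_splits)
  moreover have "\<forall>y. A y \<subseteq> B y"
    by (auto simp: B_def)
  ultimately have "B = A"
    using A unfolding maximally_monotone_def by blast
  moreover have "u \<in> B x" by (simp add: B_def)
  ultimately show ?thesis by simp
qed

text \<open>Shifting the values of \<open>A\<close> by \<open>z\<close> turns the inequalities of
  the extension lemma into the statement that \<open>(p, z - p)\<close> is monotonically related to
  the graph of \<open>A\<close>.\<close>

theorem minty:
  fixes A :: "'a::{real_inner,complete_space} \<Rightarrow> 'a set"
  assumes A: "maximally_monotone A"
  shows "\<exists>p. z - p \<in> A p"
proof -
  define S where "S = {(c, c'). c' + z \<in> A c}"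
  have mono: "\<And>x y u v. u \<in> A x \<Longrightarrow> v \<in> A y \<Longrightarrow> 0 \<le> (x - y) \<bullet> (u - v)"
    using A unfolding maximally_monotone_def monotone_op_def by blast
  have "\<exists>p. \<forall>(c, c') \<in> S. 0 \<le> (p - c) \<bullet> (- p - c')"
  proof (rule minty_extension)
    fix c c' e e' assume "(c, c') \<in> S" "(e, e') \<in> S"
    then show "0 \<le> (c - e) \<bullet> (c' - e')"
      using mono[of "c' + z" c "e' + z" e] by (simp add: S_def)
  qed
  then obtain p where p: "\<And>c c'. c' + z \<in> A c \<Longrightarrow> 0 \<le> (p - c) \<bullet> (- p - c')"
    by (auto simp: S_def)
  have "z - p \<in> A p"
    by (rule maximally_monotone_mem[OF A])
      (use p[of "v - z" for v] in \<open>force simp: algebra_simps\<close>)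
  then show ?thesis ..
qed

section \<open>Resolvents and their reflections\<close>

lemma resolvent_unique:
  assumes A: "maximally_monotone A" and p: "z - p \<in> A p" and q: "z - q \<in> A q"
  shows "p = q"
proof -
  have "0 \<le> (p - q) \<bullet> ((z - p) - (z - q))"
    using A p q unfolding maximally_monotone_def monotone_op_def by blast
  also have "\<dots> = - ((p - q) \<bullet> (p - q))"
    by (simp add: algebra_simps)
  finally have "(p - q) \<bullet> (p - q) = 0"
    by (smt (verit) inner_ge_zero)
  then show ?thesis by simp
qed

lemma resolvent_mem:
  fixes A :: "'a::{real_inner,complete_space} \<Rightarrow> 'a set"
  assumes A: "maximally_monotone A"
  shows "z - resolvent A z \<in> A (resolvent A z)"
proof -
  obtain p where p: "z - p \<in> A p"
    using minty[OF A] by blast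
  show ?thesis
    unfolding resolvent_def
  proof (rule theI)
    show "z - p \<in> A p" by (rule p)
    show "q = p" if "z - q \<in> A q" for q
      using resolvent_unique[OF A that p] .
  qed
qed

lemma resolvent_eqI:
  assumes A: "maximally_monotone A" and u: "u \<in> A x"
  shows "resolvent A (x + u) = x"
  unfolding resolvent_def
  using resolvent_unique[OF A, of "x + u"] u by (intro the_equality) auto

text \<open>The two squared norms differ by four times the monotonicity pairing at the resolvent
  points.\<close>

lemma reflected_resolvent_nonexpansive:
  fixes A :: "'a::{real_inner,complete_space} \<Rightarrow> 'a set"
  assumes A: "maximally_monotone A"
  shows "norm ((2 *\<^sub>R resolvent A z - z) - (2 *\<^sub>R resolvent A w - w)) \<le> norm (z - w)"
proof -
  define p where "p = resolvent A z"
  define q where "q = resolvent A w"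
  have "0 \<le> (p - q) \<bullet> ((z - p) - (w - q))"
    using A resolvent_mem[OF A, of z] resolvent_mem[OF A, of w]
    unfolding maximally_monotone_def monotone_op_def p_def q_def by blast
  moreover have "(norm (z - w))\<^sup>2 - (norm ((2 *\<^sub>R p - z) - (2 *\<^sub>R q - w)))\<^sup>2
      = 4 * ((p - q) \<bullet> ((z - p) - (w - q)))"
    by (simp add: power2_norm_eq_inner algebra_simps inner_commute)
  ultimately have "(norm ((2 *\<^sub>R p - z) - (2 *\<^sub>R q - w)))\<^sup>2 \<le> (norm (z - w))\<^sup>2"
    by linarith
  then show ?thesis
    unfolding p_def q_def by (rule power2_le_imp_le) simp
qed

section \<open>Krasnoselskii--Mann iterations with summable errors\<close>

text \<open>Subtracting the partial sums of the errors leaves a decreasing sequence bounded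
  below.\<close>

lemma quasi_decseq_convergent:
  fixes \<alpha> \<epsilon> :: "nat \<Rightarrow> real"
  assumes nonneg: "\<And>n. 0 \<le> \<alpha> n" "\<And>n. 0 \<le> \<epsilon> n" and le: "\<And>n. \<alpha> (Suc n) \<le> \<alpha> n + \<epsilon> n"
    and sum: "summable \<epsilon>"
  shows "convergent \<alpha>"
proof -
  define \<beta> where "\<beta> n = \<alpha> n - (\<Sum>k<n. \<epsilon> k)" for n
  have "decseq \<beta>"
    unfolding decseq_Suc_iff \<beta>_def using le by (simp add: algebra_simps)
  moreover have "- suminf \<epsilon> \<le> \<beta> n" for n
  proof -
    have "(\<Sum>k<n. \<epsilon> k) \<le> suminf \<epsilon>"
      using sum_le_suminf[OF sum] nonneg(2) by simp
    then show ?thesis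
      using nonneg(1)[of n] by (simp add: \<beta>_def)
  qed
  ultimately obtain l where "\<beta> \<longlonglongrightarrow> l"
    using decseq_convergent by metis
  then have "(\<lambda>n. \<beta> n + (\<Sum>k<n. \<epsilon> k)) \<longlonglongrightarrow> l + suminf \<epsilon>"
    by (intro tendsto_add summable_LIMSEQ sum)
  then show ?thesis
    unfolding convergent_def \<beta>_def by auto
qed

lemma summable_quasi_telescope:
  fixes \<alpha> \<beta> \<epsilon> :: "nat \<Rightarrow> real"
  assumes nonneg: "\<And>n. 0 \<le> \<alpha> n" "\<And>n. 0 \<le> \<beta> n" "\<And>n. 0 \<le> \<epsilon> n"
    and le: "\<And>n. \<alpha> (Suc n) \<le> \<alpha> n - \<beta> n + \<epsilon> n" and sum: "summable \<epsilon>"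
  shows "summable \<beta>"
proof (rule summableI_nonneg_bounded)
  have *: "(\<Sum>k<n. \<beta> k) + \<alpha> n \<le> \<alpha> 0 + (\<Sum>k<n. \<epsilon> k)" for n
  proof (induction n)
    case (Suc n)
    then show ?case using le[of n] by simp
  qed simp
  show "(\<Sum>k<n. \<beta> k) \<le> \<alpha> 0 + suminf \<epsilon>" for n
    using *[of n] nonneg(1)[of n] sum_le_suminf[OF sum, of "{..<n}"] nonneg(3) by auto
qed (rule nonneg)

lemma norm_relaxation_sq:
  fixes x y :: "'a::real_inner"
  shows "(norm (x + \<mu> *\<^sub>R (y - x)))\<^sup>2
    = (1 - \<mu>) * (norm x)\<^sup>2 + \<mu> * (norm y)\<^sup>2 - \<mu> * (1 - \<mu>) * (norm (y - x))\<^sup>2"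
  unfolding power2_norm_eq_inner
  by (simp add: algebra_simps inner_commute)

text \<open>Browder's demiclosedness principle. Expanding \<open>norm (z i - N \<zeta>)\<close>
  squared around \<open>\<zeta>\<close> exposes \<open>norm (\<zeta> - N \<zeta>)\<close> squared
  plus a cross term that vanishes by weak convergence, while nonexpansiveness bounds the same
  quantity by \<open>norm (z i - \<zeta>)\<close> squared plus terms vanishing with the
  residual.\<close>

lemma nonexpansive_demiclosed:
  fixes N :: "'a::real_inner \<Rightarrow> 'a"
  assumes nonexp: "\<And>x y. norm (N x - N y) \<le> norm (x - y)"
    and "G \<noteq> bot" and lim: "\<And>h. ((\<lambda>i. z i \<bullet> h) \<longlongrightarrow> \<zeta> \<bullet> h) G"
    and bounded: "\<forall>\<^sub>F i in G. norm (z i) \<le> C"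
    and res: "((\<lambda>i. N (z i) - z i) \<longlongrightarrow> 0) G"
  shows "N \<zeta> = \<zeta>"
proof -
  define K where "K = C + norm \<zeta>"
  define \<delta> where "\<delta> i = norm (N (z i) - z i)" for i
  have \<delta>: "(\<delta> \<longlongrightarrow> 0) G"
    unfolding \<delta>_def using tendsto_norm_zero[OF res] .
  have "((\<lambda>i. (\<delta> i)\<^sup>2 + 2 * \<delta> i * K - 2 * (z i \<bullet> (\<zeta> - N \<zeta>) - \<zeta> \<bullet> (\<zeta> - N \<zeta>)))
      \<longlongrightarrow> 0\<^sup>2 + 2 * 0 * K - 2 * (\<zeta> \<bullet> (\<zeta> - N \<zeta>) - \<zeta> \<bullet> (\<zeta> - N \<zeta>))) G"
    by (intro tendsto_intros \<delta> lim)
  moreover have "\<forall>\<^sub>F i in G. (norm (\<zeta> - N \<zeta>))\<^sup>2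
      \<le> (\<delta> i)\<^sup>2 + 2 * \<delta> i * K - 2 * (z i \<bullet> (\<zeta> - N \<zeta>) - \<zeta> \<bullet> (\<zeta> - N \<zeta>))"
    using bounded
  proof eventually_elim
    case (elim i)
    have "norm (z i - N \<zeta>) \<le> norm (z i - N (z i)) + norm (N (z i) - N \<zeta>)"
      using norm_triangle_ineq[of "z i - N (z i)" "N (z i) - N \<zeta>"] by simp
    also have "\<dots> \<le> \<delta> i + norm (z i - \<zeta>)"
      unfolding \<delta>_def using nonexp by (simp add: norm_minus_commute)
    finally have "(norm (z i - N \<zeta>))\<^sup>2 \<le> (\<delta> i + norm (z i - \<zeta>))\<^sup>2"
      by (intro power_mono) auto
    also have "\<dots> = (\<delta> i)\<^sup>2 + 2 * \<delta> i * norm (z i - \<zeta>) + (norm (z i - \<zeta>))\<^sup>2"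
      by (simp add: power2_sum)
    also have "2 * \<delta> i * norm (z i - \<zeta>) \<le> 2 * \<delta> i * K"
      using norm_triangle_ineq4[of "z i" \<zeta>] elim
      by (intro mult_left_mono) (auto simp: K_def \<delta>_def)
    finally have "(norm (z i - N \<zeta>))\<^sup>2 \<le> (\<delta> i)\<^sup>2 + 2 * \<delta> i * K + (norm (z i - \<zeta>))\<^sup>2"
      by simp
    moreover have "(norm (z i - N \<zeta>))\<^sup>2
        = (norm (z i - \<zeta>))\<^sup>2 + 2 * (z i \<bullet> (\<zeta> - N \<zeta>) - \<zeta> \<bullet> (\<zeta> - N \<zeta>)) + (norm (\<zeta> - N \<zeta>))\<^sup>2"
      by (simp add: power2_norm_eq_inner algebra_simps inner_commute)
    ultimately show ?case by linarith
  qed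
  ultimately have "(norm (\<zeta> - N \<zeta>))\<^sup>2 \<le> 0\<^sup>2 + 2 * 0 * K - 2 * (\<zeta> \<bullet> (\<zeta> - N \<zeta>) - \<zeta> \<bullet> (\<zeta> - N \<zeta>))"
    using tendsto_lowerbound \<open>G \<noteq> bot\<close> by blast
  then show ?thesis by simp
qed

text \<open>Opial's lemma: bounded sequences have weak cluster points, and convergence of the
  distances to \<open>S\<close> allows only one.\<close>

lemma opial:
  fixes z :: "nat \<Rightarrow> 'a::{real_inner,complete_space}"
  assumes conv: "\<And>f. f \<in> S \<Longrightarrow> convergent (\<lambda>n. norm (z n - f))" and "S \<noteq> {}"
    and cluster: "\<And>G \<xi>. G \<noteq> bot \<Longrightarrow> G \<le> sequentially \<Longrightarrow>
      (\<And>h. ((\<lambda>n. z n \<bullet> h) \<longlongrightarrow> \<xi> \<bullet> h) G) \<Longrightarrow> \<xi> \<in> S"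
  shows "\<exists>\<zeta>\<in>S. weak_conv z \<zeta>"
proof -
  obtain f0 where f0: "f0 \<in> S" using \<open>S \<noteq> {}\<close> by blast
  then have "Bseq (\<lambda>n. norm (z n - f0))"
    using conv convergent_imp_Bseq by blast
  then obtain K where K: "\<And>n. norm (z n - f0) \<le> K"
    unfolding Bseq_def by auto
  have bounded: "norm (z n) \<le> K + norm f0" for n
    using K[of n] norm_triangle_ineq[of "z n - f0" f0] by simp
  have cluster_point: "\<exists>G \<xi>. G \<noteq> bot \<and> G \<le> F \<and> (\<forall>h. ((\<lambda>n. z n \<bullet> h) \<longlongrightarrow> \<xi> \<bullet> h) G)"
    if F: "F \<noteq> bot" for F
    using bounded_weak_cluster_point[of F z "K + norm f0", OF F] bounded by (metis always_eventually)
  obtain G \<zeta> where G: "G \<noteq> bot" "G \<le> sequentially" "\<And>h. ((\<lambda>n. z n \<bullet> h) \<longlongrightarrow> \<zeta> \<bullet> h) G"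
    using cluster_point[of sequentially] by auto
  have \<zeta>: "\<zeta> \<in> S" using cluster[OF G] .
  have unique: "\<xi> = \<zeta>"
    if H: "H \<noteq> bot" "H \<le> sequentially" "\<And>h. ((\<lambda>n. z n \<bullet> h) \<longlongrightarrow> \<xi> \<bullet> h) H" for H \<xi>
  proof -
    obtain k l where kl: "(\<lambda>n. norm (z n - \<zeta>)) \<longlonglongrightarrow> k" "(\<lambda>n. norm (z n - \<xi>)) \<longlonglongrightarrow> l"
      using conv[OF \<zeta>] conv[OF cluster[OF H]] unfolding convergent_def by blast
    \<comment> \<open>Polarisation: the two distances determine the inner product with
      \<open>\<xi> - \<zeta>\<close>, which therefore converges along the whole sequence, so both
      cluster points give the same limit.\<close>
    have eq: "z n \<bullet> (\<xi> - \<zeta>)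
        = ((norm (z n - \<zeta>))\<^sup>2 - (norm (z n - \<xi>))\<^sup>2 + (norm \<xi>)\<^sup>2 - (norm \<zeta>)\<^sup>2) / 2" for n
      by (simp add: power2_norm_eq_inner algebra_simps inner_commute)
    define m where "m = (k\<^sup>2 - l\<^sup>2 + (norm \<xi>)\<^sup>2 - (norm \<zeta>)\<^sup>2) / 2"
    have lim: "(\<lambda>n. z n \<bullet> (\<xi> - \<zeta>)) \<longlonglongrightarrow> m"
      unfolding eq m_def by (intro tendsto_intros kl) simp
    have "\<zeta> \<bullet> (\<xi> - \<zeta>) = m" "\<xi> \<bullet> (\<xi> - \<zeta>) = m"
      using tendsto_unique[OF G(1) G(3) tendsto_mono[OF G(2) lim]]
        tendsto_unique[OF H(1) H(3) tendsto_mono[OF H(2) lim]] by auto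
    then have "(\<xi> - \<zeta>) \<bullet> (\<xi> - \<zeta>) = 0"
      by (simp add: inner_diff_left)
    then show ?thesis by simp
  qed
  have "(\<lambda>n. z n \<bullet> h) \<longlonglongrightarrow> \<zeta> \<bullet> h" for h
  proof (rule tendstoI, rule ccontr)
    fix e :: real assume "0 < e"
      and not_ev: "\<not> (\<forall>\<^sub>F n in sequentially. dist (z n \<bullet> h) (\<zeta> \<bullet> h) < e)"
    \<comment> \<open>Restriction to the indices violating the estimate; a cluster point found there
      is again \<open>\<zeta>\<close>, a contradiction.\<close>
    define F where "F = inf sequentially (principal {n. \<not> dist (z n \<bullet> h) (\<zeta> \<bullet> h) < e})"
    have "F \<noteq> bot"
      using not_ev unfolding F_def trivial_limit_def eventually_inf_principal by simp
    then obtain H \<xi> where H: "H \<noteq> bot" "H \<le> F" "\<And>h. ((\<lambda>n. z n \<bullet> h) \<longlongrightarrow> \<xi> \<bullet> h) H"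
      using cluster_point by blast
    have "H \<le> sequentially" using H(2) by (simp add: F_def)
    then have "\<xi> = \<zeta>" using unique H by blast
    then have "\<forall>\<^sub>F n in H. dist (z n \<bullet> h) (\<zeta> \<bullet> h) < e"
      using tendstoD[OF H(3) \<open>0 < e\<close>] by blast
    moreover have "\<forall>\<^sub>F n in F. \<not> dist (z n \<bullet> h) (\<zeta> \<bullet> h) < e"
      by (simp add: F_def eventually_inf_principal)
    then have "\<forall>\<^sub>F n in H. \<not> dist (z n \<bullet> h) (\<zeta> \<bullet> h) < e"
      using H(2) filter_leD by blast
    ultimately have "\<forall>\<^sub>F n in H. False"
      by eventually_elim blast
    then show False using H(1) by simp
  qed
  then show ?thesis
    unfolding weak_conv_def using \<zeta> by blast
qed

text \<open>Distances to fixed points decrease up to summable errors, which makes the weighted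
  squared residuals summable. The residual norms are themselves decreasing up to errors, so they
  converge, and divergence of the weights forces their limit to be 0. Opial's lemma and
  demiclosedness then give weak convergence.\<close>

theorem krasnoselskii_mann:
  fixes N :: "'a::{real_inner,complete_space} \<Rightarrow> 'a"
  assumes nonexp: "\<And>x y. norm (N x - N y) \<le> norm (x - y)"
    and fix_ex: "\<exists>f. N f = f"
    and \<mu>: "\<And>n. 0 \<le> \<mu> n" "\<And>n. \<mu> n \<le> 1"
    and div: "\<not> summable (\<lambda>n. \<mu> n * (1 - \<mu> n))"
    and err: "summable (\<lambda>n. norm (e n))"
    and step: "\<And>n. z (Suc n) = z n + \<mu> n *\<^sub>R (N (z n) - z n) + e n"
  shows "(\<lambda>n. N (z n) - z n) \<longlonglongrightarrow> 0" and "\<exists>\<zeta>. N \<zeta> = \<zeta> \<and> weak_conv z \<zeta>"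
proof -
  \<comment> \<open>The error-free step, for which the Fejer estimates hold exactly.\<close>
  define z' where "z' n = z n + \<mu> n *\<^sub>R (N (z n) - z n)" for n
  define d where "d n = norm (N (z n) - z n)" for n
  have step': "z (Suc n) = z' n + e n" for n
    by (simp add: step z'_def)
  have sq: "(norm (z' n - f))\<^sup>2 \<le> (norm (z n - f))\<^sup>2 - \<mu> n * (1 - \<mu> n) * (d n)\<^sup>2"
    if f: "N f = f" for f n
  proof -
    have "norm (N (z n) - f) \<le> norm (z n - f)"
      using nonexp[of "z n" f] f by simp
    then have "\<mu> n * (norm (N (z n) - f))\<^sup>2 \<le> \<mu> n * (norm (z n - f))\<^sup>2"
      using \<mu> by (intro mult_left_mono power_mono) auto
    moreover have "z' n - f = (z n - f) + \<mu> n *\<^sub>R ((N (z n) - f) - (z n - f))"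
      by (simp add: z'_def)
    then have "(norm (z' n - f))\<^sup>2 = (1 - \<mu> n) * (norm (z n - f))\<^sup>2
        + \<mu> n * (norm (N (z n) - f))\<^sup>2 - \<mu> n * (1 - \<mu> n) * (d n)\<^sup>2"
      by (simp only: norm_relaxation_sq) (simp add: d_def)
    ultimately show ?thesis by (simp add: algebra_simps)
  qed
  have fejer: "norm (z' n - f) \<le> norm (z n - f)" if f: "N f = f" for f n
  proof (rule power2_le_imp_le)
    have "0 \<le> \<mu> n * (1 - \<mu> n) * (d n)\<^sup>2" using \<mu> by simp
    then show "(norm (z' n - f))\<^sup>2 \<le> (norm (z n - f))\<^sup>2" using sq[OF f, of n] by linarith
  qed simp
  have conv: "convergent (\<lambda>n. norm (z n - f))" if f: "N f = f" for f
  proof (rule quasi_decseq_convergent[OF _ _ _ err])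
    show "norm (z (Suc n) - f) \<le> norm (z n - f) + norm (e n)" for n
      using norm_triangle_ineq[of "z' n - f" "e n"] fejer[OF f, of n] by (simp add: step' algebra_simps)
  qed auto
  obtain f where f: "N f = f" using fix_ex by blast
  obtain K where K: "\<And>n. norm (z n - f) \<le> K"
    using convergent_imp_Bseq[OF conv[OF f]] unfolding Bseq_def by auto
  obtain E where E: "\<And>n. norm (e n) \<le> E"
    using convergent_imp_Bseq[OF convergentI[OF summable_LIMSEQ_zero[OF err]]] unfolding Bseq_def by auto
  have sum_d: "summable (\<lambda>n. \<mu> n * (1 - \<mu> n) * (d n)\<^sup>2)"
  proof (rule summable_quasi_telescope)
    \<comment> \<open>Squaring the perturbed distance adds
      \<open>(2 * norm (z' n - f) + norm (e n)) * norm (e n)\<close>; the bounds \<open>K\<close>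
      and \<open>E\<close> make this a constant multiple of the error.\<close>
    show "summable (\<lambda>n. (2 * K + E) * norm (e n))"
      using err by (rule summable_mult)
    fix n
    have "norm (z (Suc n) - f) \<le> norm (z' n - f) + norm (e n)"
      using norm_triangle_ineq[of "z' n - f" "e n"] by (simp add: step' algebra_simps)
    then have "(norm (z (Suc n) - f))\<^sup>2 \<le> (norm (z' n - f) + norm (e n))\<^sup>2"
      by (intro power_mono) auto
    also have "\<dots> = (norm (z' n - f))\<^sup>2 + (2 * norm (z' n - f) + norm (e n)) * norm (e n)"
      by (simp add: power2_eq_square algebra_simps)
    also have "(2 * norm (z' n - f) + norm (e n)) * norm (e n) \<le> (2 * K + E) * norm (e n)"
      using fejer[OF f, of n] K[of n] E[of n] by (intro mult_right_mono) auto
    finally show "(norm (z (Suc n) - f))\<^sup>2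
        \<le> (norm (z n - f))\<^sup>2 - \<mu> n * (1 - \<mu> n) * (d n)\<^sup>2 + (2 * K + E) * norm (e n)"
      using sq[OF f, of n] by simp
    have "0 \<le> K" "0 \<le> E" using order_trans[OF norm_ge_zero K] order_trans[OF norm_ge_zero E] by auto
    then show "0 \<le> (2 * K + E) * norm (e n)" by simp
  qed (use \<mu> in auto)
  have "convergent d"
  proof (rule quasi_decseq_convergent)
    show "summable (\<lambda>n. 2 * norm (e n))"
      using err by (rule summable_mult)
    fix n
    have "norm (z' n - z n) = \<mu> n * d n"
      using \<mu> by (simp add: z'_def d_def)
    then have 1: "norm (N (z' n) - N (z n)) \<le> \<mu> n * d n"
      using nonexp[of "z' n" "z n"] by simp
    have "N (z n) - z' n = (1 - \<mu> n) *\<^sub>R (N (z n) - z n)"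
      by (simp add: z'_def algebra_simps)
    then have 2: "norm (N (z n) - z' n) = (1 - \<mu> n) * d n"
      using \<mu> by (simp add: d_def)
    have 3: "norm (N (z (Suc n)) - N (z' n)) \<le> norm (e n)"
      using nonexp[of "z (Suc n)" "z' n"] by (simp add: step')
    \<comment> \<open>The middle differences contribute the shares \<open>\<mu> n\<close> and
      \<open>1 - \<mu> n\<close> of \<open>d n\<close>; the error enters twice, through
      \<open>N\<close> and directly.\<close>
    have "N (z (Suc n)) - z (Suc n)
        = (N (z (Suc n)) - N (z' n)) + (N (z' n) - N (z n)) + (N (z n) - z' n) - e n"
      by (simp add: step')
    then have "d (Suc n) \<le> norm (N (z (Suc n)) - N (z' n)) + norm (N (z' n) - N (z n))
        + norm (N (z n) - z' n) + norm (e n)"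
      unfolding d_def by (metis (no_types, lifting) add_mono norm_triangle_le norm_triangle_le_diff order_refl)
    then show "d (Suc n) \<le> d n + 2 * norm (e n)"
      using 1 2 3 by (simp add: algebra_simps)
  qed (auto simp: d_def)
  then obtain l where l: "d \<longlonglongrightarrow> l" by (auto simp: convergent_def)
  have "0 \<le> l"
    using l by (rule LIMSEQ_le_const) (auto simp: d_def)
  have "l = 0"
  proof (rule ccontr)
    assume "l \<noteq> 0"
    then have "0 < l" using \<open>0 \<le> l\<close> by simp
    then have "\<forall>\<^sub>F n in sequentially. l / 2 < d n"
      using order_tendstoD(1)[OF l, of "l / 2"] by simp
    \<comment> \<open>A positive limit would keep \<open>d\<close> above \<open>l / 2\<close>, so
      the weights would be dominated by a multiple of the summable series
      \<open>sum_d\<close>.\<close>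
    then have "\<forall>\<^sub>F n in sequentially.
        norm (\<mu> n * (1 - \<mu> n)) \<le> (4 / l\<^sup>2) * (\<mu> n * (1 - \<mu> n) * (d n)\<^sup>2)"
    proof eventually_elim
      case (elim n)
      have nonneg: "0 \<le> \<mu> n * (1 - \<mu> n)" using \<mu> by simp
      have "(l / 2)\<^sup>2 \<le> (d n)\<^sup>2"
        using elim \<open>0 < l\<close> by (intro power_mono) auto
      then have "1 \<le> (4 / l\<^sup>2) * (d n)\<^sup>2"
        using \<open>0 < l\<close> by (simp add: power_divide field_simps)
      from mult_left_mono[OF this nonneg] show ?case
        using nonneg by (simp add: mult_ac)
    qed
    then have "summable (\<lambda>n. \<mu> n * (1 - \<mu> n))"
      by (rule summable_comparison_test_ev) (intro summable_mult sum_d)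
    with div show False by blast
  qed
  then show res: "(\<lambda>n. N (z n) - z n) \<longlonglongrightarrow> 0"
    using l tendsto_norm_zero_cancel[of "\<lambda>n. N (z n) - z n"] unfolding d_def by blast
  have "\<exists>\<zeta>\<in>{f. N f = f}. weak_conv z \<zeta>"
  proof (rule opial)
    fix G \<xi>
    assume G: "G \<noteq> bot" "G \<le> sequentially" "\<And>h. ((\<lambda>n. z n \<bullet> h) \<longlongrightarrow> \<xi> \<bullet> h) G"
    have "\<forall>\<^sub>F n in G. norm (z n) \<le> K + norm f"
    proof (rule always_eventually, rule allI)
      show "norm (z n) \<le> K + norm f" for n
        using K[of n] norm_triangle_ineq[of "z n - f" f] by simp
    qed
    then have "N \<xi> = \<xi>"
      using nonexpansive_demiclosed[OF nonexp G(1,3)] tendsto_mono[OF G(2) res] by blast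
    then show "\<xi> \<in> {f. N f = f}" by simp
  qed (use conv f in auto)
  then show "\<exists>\<zeta>. N \<zeta> = \<zeta> \<and> weak_conv z \<zeta>" by blast
qed

section \<open>The Spingarn operator on the graph of \<open>L\<close>\<close>

definition graph_proj :: "('a::real_inner \<Rightarrow> 'b::real_inner) \<Rightarrow> 'a \<times> 'b \<Rightarrow> 'a \<times> 'b" where
  "graph_proj L z = (let w = Qop L (fst z + hadjoint L (snd z)) in (w, L w))"

definition prod_resolvent ::
  "('a::real_inner \<Rightarrow> 'a set) \<Rightarrow> ('b::real_inner \<Rightarrow> 'b set) \<Rightarrow> 'a \<times> 'b \<Rightarrow> 'a \<times> 'b" where
  "prod_resolvent A B z = (resolvent A (fst z), resolvent B (snd z))"

definition graph_reflection :: "('a::real_inner \<Rightarrow> 'b::real_inner) \<Rightarrow> 'a \<times> 'b \<Rightarrow> 'a \<times> 'b" where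
  "graph_reflection L z = 2 *\<^sub>R graph_proj L z - z"

text \<open>The Peaceman--Rachford operator of the product of \<open>A\<close> and \<open>B\<close>
  and the normal cone operator of the graph of \<open>L\<close>: a composite of two
  reflections.\<close>

definition spingarn_op ::
  "('a::real_inner \<Rightarrow> 'a set) \<Rightarrow> ('b::real_inner \<Rightarrow> 'b set) \<Rightarrow> ('a \<Rightarrow> 'b) \<Rightarrow> 'a \<times> 'b \<Rightarrow> 'a \<times> 'b" where
  "spingarn_op A B L z = graph_reflection L (2 *\<^sub>R prod_resolvent A B z - z)"

context
  fixes L :: "'a::{real_inner,complete_space} \<Rightarrow> 'b::{real_inner,complete_space}"
  assumes L: "bounded_linear L"
begin

interpretation L: bounded_linear L by (rule L)
interpretation H: linear "hadjoint L" by (rule linear_hadjoint[OF L])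

lemma graph_proj_range:
  obtains x where "graph_proj L z = (x, L x)"
  by (auto simp: graph_proj_def Let_def)

text \<open>This is the equation defining \<open>Q\<close>, rearranged.\<close>

lemma graph_proj_orthogonal:
  obtains v where "z - graph_proj L z = (- hadjoint L v, v)"
proof -
  define w where "w = Qop L (fst z + hadjoint L (snd z))"
  have "w + hadjoint L (L w) = fst z + hadjoint L (snd z)"
    unfolding w_def by (rule Qop_eq[OF L])
  moreover have "graph_proj L z = (w, L w)"
    by (simp add: graph_proj_def w_def Let_def)
  ultimately have "z - graph_proj L z = (- hadjoint L (snd z - L w), snd z - L w)"
    by (cases z) (simp add: H.diff algebra_simps)
  then show thesis by (rule that)
qed

lemma graph_proj_eqI: "graph_proj L (x - hadjoint L v, L x + v) = (x, L x)"
proof -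
  have "x + hadjoint L (L x) = (x - hadjoint L v) + hadjoint L (L x + v)"
    by (simp add: H.add)
  then have "Qop L ((x - hadjoint L v) + hadjoint L (L x + v)) = x"
    using Qop_unique[OF L] Qop_eq[OF L] by metis
  then show ?thesis by (simp add: graph_proj_def)
qed

lemma inner_graph_proj:
  "graph_proj L y \<bullet> (z - graph_proj L z) = 0"
proof -
  obtain x v where "graph_proj L y = (x, L x)" "z - graph_proj L z = (- hadjoint L v, v)"
    by (metis graph_proj_range graph_proj_orthogonal)
  then show ?thesis
    by (simp add: inner_hadjoint[OF L])
qed

lemma graph_proj_selfadjoint: "graph_proj L y \<bullet> z = y \<bullet> graph_proj L z"
  using inner_graph_proj[of y z] inner_graph_proj[of z y]
  by (simp add: inner_diff_right inner_commute)

text \<open>Self-adjointness gives linearity: pairing with an arbitrary vector moves the projection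
  to the other side.\<close>

lemma linear_graph_proj: "linear (graph_proj L)"
proof (rule linearI)
  show "graph_proj L (x + y) = graph_proj L x + graph_proj L y" for x y
    by (rule vector_eq_ldot[THEN iffD1])
      (simp add: graph_proj_selfadjoint[symmetric] inner_add_right)
  show "graph_proj L (c *\<^sub>R x) = c *\<^sub>R graph_proj L x" for c x
    by (rule vector_eq_ldot[THEN iffD1])
      (simp add: graph_proj_selfadjoint[symmetric])
qed

interpretation P: linear "graph_proj L" by (rule linear_graph_proj)

lemma graph_proj_idem: "graph_proj L (graph_proj L z) = graph_proj L z"
proof -
  obtain x where x: "graph_proj L z = (x, L x)" by (rule graph_proj_range)
  then show ?thesis using graph_proj_eqI[of x 0] by (simp add: H.zero)
qed

lemma norm_graph_reflection: "norm (graph_reflection L z) = norm z"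
proof -
  have "(norm (2 *\<^sub>R graph_proj L z - z))\<^sup>2 = (norm z)\<^sup>2 - 4 * (graph_proj L z \<bullet> (z - graph_proj L z))"
    unfolding power2_norm_eq_inner by (simp add: algebra_simps inner_commute)
  then have "(norm (2 *\<^sub>R graph_proj L z - z))\<^sup>2 = (norm z)\<^sup>2"
    using inner_graph_proj by simp
  then show ?thesis
    by (simp add: graph_reflection_def power2_eq_iff_nonneg)
qed

lemma linear_graph_reflection: "linear (graph_reflection L)"
  by (rule linearI) (simp_all add: graph_reflection_def P.add P.scaleR algebra_simps)

text \<open>The projection is the mean of the identity and an isometry, hence has norm at most
  1.\<close>

lemma bounded_linear_graph_proj: "bounded_linear (graph_proj L)"
proof (rule bounded_linear_intro)
  show "norm (graph_proj L z) \<le> norm z * 1" for z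
  proof -
    have "2 *\<^sub>R graph_proj L z = graph_reflection L z + z" by (simp add: graph_reflection_def)
    then have "2 * norm (graph_proj L z) \<le> norm (graph_reflection L z) + norm z"
      by (metis norm_scaleR norm_triangle_ineq abs_numeral)
    then show ?thesis by (simp add: norm_graph_reflection)
  qed
qed (simp_all add: P.add P.scaleR)

context
  fixes A :: "'a \<Rightarrow> 'a set" and B :: "'b \<Rightarrow> 'b set"
  assumes A: "maximally_monotone A" and B: "maximally_monotone B"
begin

lemma spingarn_op_nonexpansive:
  "norm (spingarn_op A B L y - spingarn_op A B L z) \<le> norm (y - z)"
proof -
  have "norm (spingarn_op A B L y - spingarn_op A B L z)
      = norm ((2 *\<^sub>R prod_resolvent A B y - y) - (2 *\<^sub>R prod_resolvent A B z - z))"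
    unfolding spingarn_op_def
    by (simp only: linear_diff[OF linear_graph_reflection, symmetric] norm_graph_reflection)
  also have "\<dots> \<le> norm (y - z)"
    using reflected_resolvent_nonexpansive[OF A, of "fst y" "fst z"]
      reflected_resolvent_nonexpansive[OF B, of "snd y" "snd z"]
    by (cases y; cases z) (auto simp: prod_resolvent_def norm_Pair intro!: real_sqrt_le_mono add_mono power_mono)
  finally show ?thesis .
qed

lemma spingarn_op_minus:
  "spingarn_op A B L z - z
    = 2 *\<^sub>R (2 *\<^sub>R graph_proj L (prod_resolvent A B z) - graph_proj L z - prod_resolvent A B z)"
  by (simp add: spingarn_op_def graph_reflection_def P.diff P.scaleR algebra_simps)

text \<open>Isolates the graph component of the residual; it serves both the fixed point analysis
  and the strong limits.\<close>

lemma graph_proj_spingarn_op_minus: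
  "graph_proj L (spingarn_op A B L z - z)
    = 2 *\<^sub>R (graph_proj L (prod_resolvent A B z) - graph_proj L z)"
  unfolding spingarn_op_minus P.scaleR P.diff graph_proj_idem
  by (simp add: algebra_simps scaleR_2)

lemma spingarn_op_fixed_point:
  assumes "- hadjoint L v \<in> A x" "v \<in> B (L x)"
  shows "spingarn_op A B L (x - hadjoint L v, L x + v) = (x - hadjoint L v, L x + v)"
proof -
  have "prod_resolvent A B (x - hadjoint L v, L x + v) = (x, L x)"
    using resolvent_eqI[OF A assms(1)] resolvent_eqI[OF B assms(2)] by (simp add: prod_resolvent_def)
  then have "spingarn_op A B L (x - hadjoint L v, L x + v) - (x - hadjoint L v, L x + v) = 0"
    unfolding spingarn_op_minus
    using graph_proj_eqI[of x 0] graph_proj_eqI[of x v] by (simp add: H.zero scaleR_2)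
  then show ?thesis by simp
qed

text \<open>Projecting the fixed point equation equates the projections of \<open>z\<close> and of
  its resolvent; inserted back, this makes the resolvent of \<open>z\<close> equal to its
  projection. The two components of that equality are the inclusions.\<close>

lemma spingarn_op_fixed_pointE:
  assumes fp: "spingarn_op A B L z = z"
  obtains x v where "z = (x - hadjoint L v, L x + v)" "- hadjoint L v \<in> A x" "v \<in> B (L x)"
proof -
  have "graph_proj L (prod_resolvent A B z) = graph_proj L z"
    using graph_proj_spingarn_op_minus[of z] fp by (simp add: P.zero)
  then have "2 *\<^sub>R (2 *\<^sub>R graph_proj L z - graph_proj L z - prod_resolvent A B z) = 0"
    using spingarn_op_minus[of z] fp by simp
  then have J: "prod_resolvent A B z = graph_proj L z"
    unfolding scaleR_eq_0_iff by (simp add: scaleR_2)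
  obtain x where x: "graph_proj L z = (x, L x)" by (rule graph_proj_range)
  obtain v where v: "z - graph_proj L z = (- hadjoint L v, v)" by (rule graph_proj_orthogonal)
  have z: "z = (x - hadjoint L v, L x + v)"
    using v x by (metis add.commute add_Pair diff_add_cancel diff_conv_add_uminus)
  have "resolvent A (x - hadjoint L v) = x" "resolvent B (L x + v) = L x"
    using J x unfolding z prod_resolvent_def by auto
  then have "- hadjoint L v \<in> A x" "v \<in> B (L x)"
    using resolvent_mem[OF A, of "x - hadjoint L v"] resolvent_mem[OF B, of "L x + v"] by auto
  with z show thesis by (rule that)
qed

end

end

section \<open>Convergence of the primal-dual iteration\<close>

theorem theorem3p2:
  fixes A :: "'a::{real_inner,complete_space} \<Rightarrow> 'a set"
    and B :: "'b::{real_inner,complete_space} \<Rightarrow> 'b set"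
    and L :: "'a \<Rightarrow> 'b"
    and lam :: "nat \<Rightarrow> real"
    and a :: "nat \<Rightarrow> 'a" and b :: "nat \<Rightarrow> 'b"
    and x u p r t w :: "nat \<Rightarrow> 'a"
    and y v q s :: "nat \<Rightarrow> 'b"
    and x0 :: 'a and v0 :: 'b
  assumes mmA: "maximally_monotone A"
    and mmB: "maximally_monotone B"
    and L: "bounded_linear L"
    and zer: "\<exists>z. primal_sol A B L z"
    and lam_range: "\<And>n. 0 < lam n \<and> lam n < 2"
    and lam_div: "\<not> summable (\<lambda>n. lam n * (2 - lam n))"
    and err_sum: "summable (\<lambda>n. lam n * sqrt ((norm (a n))\<^sup>2 + (norm (b n))\<^sup>2))"
    and x_0: "x 0 = x0" and v_0: "v 0 = v0"
    and y_0: "y 0 = L x0" and u_0: "u 0 = - hadjoint L v0"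
    and p_def: "\<And>n. p n = resolvent A (x n + u n) + a n"
    and q_def: "\<And>n. q n = resolvent B (y n + v n) + b n"
    and r_def: "\<And>n. r n = x n + u n - p n"
    and s_def: "\<And>n. s n = y n + v n - q n"
    and t_def: "\<And>n. t n = Qop L (r n + hadjoint L (s n))"
    and w_def: "\<And>n. w n = Qop L (p n + hadjoint L (q n))"
    and x_Suc: "\<And>n. x (Suc n) = x n - lam n *\<^sub>R t n"
    and y_Suc: "\<And>n. y (Suc n) = y n - lam n *\<^sub>R L (t n)"
    and u_Suc: "\<And>n. u (Suc n) = u n + lam n *\<^sub>R (w n - p n)"
    and v_Suc: "\<And>n. v (Suc n) = v n + lam n *\<^sub>R (L (w n) - q n)"
  shows "(\<lambda>n. x n - w n + Qop L (a n + hadjoint L (b n))) \<longlonglongrightarrow> 0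
    \<and> (\<lambda>n. y n - L (w n) + L (Qop L (a n + hadjoint L (b n)))) \<longlonglongrightarrow> 0
    \<and> (\<lambda>n. u n - r n + t n - a n + Qop L (a n + hadjoint L (b n))) \<longlonglongrightarrow> 0
    \<and> (\<lambda>n. v n - s n + L (t n) - b n + L (Qop L (a n + hadjoint L (b n)))) \<longlonglongrightarrow> 0
    \<and> (\<exists>xb vb. primal_sol A B L xb \<and> dual_sol A B L vb
          \<and> - hadjoint L vb \<in> A xb \<and> vb \<in> B (L xb)
          \<and> weak_conv x xb \<and> weak_conv v vb)"
proof -
  interpret L: bounded_linear L by (rule L)
  interpret H: linear "hadjoint L" by (rule linear_hadjoint[OF L])
  interpret P: bounded_linear "graph_proj L" by (rule bounded_linear_graph_proj[OF L])
  define P where "P = graph_proj L"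
  define J where "J = prod_resolvent A B"
  define N where "N = spingarn_op A B L"
  define Z where "Z n = (x n + u n, y n + v n)" for n
  define e where "e n = (a n, b n)" for n
  have pq: "(p n, q n) = J (Z n) + e n" for n
    by (simp add: p_def q_def J_def Z_def e_def prod_resolvent_def)
  have rs: "(r n, s n) = Z n - J (Z n) - e n" for n
    unfolding diff_diff_add pq[symmetric] by (simp add: r_def s_def Z_def)
  have w: "(w n, L (w n)) = P (J (Z n)) + P (e n)" for n
    unfolding P_def P.add[symmetric] pq[symmetric] by (simp add: w_def graph_proj_def Let_def)
  have t: "(t n, L (t n)) = P (Z n) - P (J (Z n)) - P (e n)" for n
    unfolding P_def P.diff[symmetric] rs[symmetric] by (simp add: t_def graph_proj_def Let_def)
  have Pe: "(Qop L (a n + hadjoint L (b n)), L (Qop L (a n + hadjoint L (b n)))) = P (e n)" for n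
    by (simp add: P_def e_def graph_proj_def Let_def)
  \<comment> \<open>\<open>(x n, y n)\<close> stays in the graph since its increments are multiples
    of \<open>(t n, L (t n))\<close>; \<open>(u n, v n)\<close> stays in the orthogonal complement
    by the equation for \<open>Q\<close>.\<close>
  have inv: "y n = L (x n) \<and> u n = - hadjoint L (v n)" for n
  proof (induction n)
    case 0
    then show ?case by (simp add: x_0 v_0 y_0 u_0)
  next
    case (Suc n)
    have "w n + hadjoint L (L (w n)) = p n + hadjoint L (q n)"
      unfolding w_def by (rule Qop_eq[OF L])
    then have "w n - p n = - hadjoint L (L (w n) - q n)"
      by (simp add: H.diff algebra_simps)
    then show ?case
      using Suc by (simp add: x_Suc y_Suc u_Suc v_Suc L.diff L.scaleR H.add H.scale)
  qed
  have PZ: "(x n, y n) = P (Z n)" and PZ': "(u n, v n) = Z n - P (Z n)" for n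
  proof -
    show xy: "(x n, y n) = P (Z n)"
      using graph_proj_eqI[OF L, of "x n" "v n"] inv[of n] by (simp add: P_def Z_def)
    show "(u n, v n) = Z n - P (Z n)"
      unfolding xy[symmetric] by (simp add: Z_def)
  qed
  have NZ: "N z - z = 2 *\<^sub>R (2 *\<^sub>R P (J z) - P z - J z)" for z
    unfolding N_def P_def J_def by (rule spingarn_op_minus[OF L mmA mmB])
  have PNZ: "P (N z - z) = 2 *\<^sub>R (P (J z) - P z)" for z
    unfolding N_def P_def J_def by (rule graph_proj_spingarn_op_minus[OF L mmA mmB])
  \<comment> \<open>The error enters \<open>t n\<close> and \<open>w n\<close> as its projection and
    \<open>(p n, q n)\<close> as itself, so the total is twice the projection minus the error: its
    reflection.\<close>
  have step: "Z (Suc n) = Z n + (lam n / 2) *\<^sub>R (N (Z n) - Z n) + lam n *\<^sub>R graph_reflection L (e n)" for n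
  proof -
    have N: "(lam n / 2) *\<^sub>R (N (Z n) - Z n) = lam n *\<^sub>R (2 *\<^sub>R P (J (Z n)) - P (Z n) - J (Z n))"
      unfolding NZ by simp
    have "Z (Suc n) = Z n - lam n *\<^sub>R (t n, L (t n)) + lam n *\<^sub>R ((w n, L (w n)) - (p n, q n))"
      by (simp add: Z_def x_Suc y_Suc u_Suc v_Suc)
    also have "\<dots> = Z n + (lam n / 2) *\<^sub>R (N (Z n) - Z n) + lam n *\<^sub>R graph_reflection L (e n)"
      unfolding t w pq N graph_reflection_def P_def[symmetric]
      by (simp add: algebra_simps scaleR_2)
    finally show ?thesis .
  qed
  have fix_ex: "\<exists>f. N f = f"
  proof -
    obtain z c d where "c \<in> A z" "d \<in> B (L z)" "c + hadjoint L d = 0"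
      using zer unfolding primal_sol_def by blast
    then have "- hadjoint L d \<in> A z" "d \<in> B (L z)"
      by (simp_all add: eq_neg_iff_add_eq_0[symmetric])
    then show ?thesis
      using spingarn_op_fixed_point[OF L mmA mmB] unfolding N_def by blast
  qed
  have nonexp: "norm (N y - N z) \<le> norm (y - z)" for y z
    unfolding N_def by (rule spingarn_op_nonexpansive[OF L mmA mmB])
  \<comment> \<open>Relaxation by \<open>lam n\<close> is the Krasnoselskii--Mann step with weight
    \<open>lam n / 2\<close>.\<close>
  have mu: "0 \<le> lam n / 2" "lam n / 2 \<le> 1" for n
    using lam_range[of n] by auto
  have div: "\<not> summable (\<lambda>n. lam n / 2 * (1 - lam n / 2))"
  proof
    assume "summable (\<lambda>n. lam n / 2 * (1 - lam n / 2))"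
    then have "summable (\<lambda>n. 4 * (lam n / 2 * (1 - lam n / 2)))" by (rule summable_mult)
    moreover have "(\<lambda>n. 4 * (lam n / 2 * (1 - lam n / 2))) = (\<lambda>n. lam n * (2 - lam n))"
      by (simp add: fun_eq_iff algebra_simps)
    ultimately show False using lam_div by (simp only:)
  qed
  \<comment> \<open>The reflection is an isometry, so the error norms are exactly the terms assumed
    summable.\<close>
  have "norm (lam n *\<^sub>R graph_reflection L (e n)) = lam n * sqrt ((norm (a n))\<^sup>2 + (norm (b n))\<^sup>2)" for n
    using lam_range[of n] by (simp add: norm_graph_reflection[OF L] e_def norm_Pair)
  then have err: "summable (\<lambda>n. norm (lam n *\<^sub>R graph_reflection L (e n)))"
    using err_sum by simp
  have res: "(\<lambda>n. N (Z n) - Z n) \<longlonglongrightarrow> 0" and "\<exists>\<zeta>. N \<zeta> = \<zeta> \<and> weak_conv Z \<zeta>"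
    using krasnoselskii_mann[OF nonexp fix_ex mu div err step] by auto
  then obtain \<zeta> where \<zeta>: "N \<zeta> = \<zeta>" "weak_conv Z \<zeta>" by blast
  have Pres: "(\<lambda>n. P (N (Z n) - Z n)) \<longlonglongrightarrow> 0"
    using P.tendsto[OF res] by (simp add: P_def P.zero)
  \<comment> \<open>Limit (i) is the graph component of the residual; the added \<open>Q\<close>
    terms cancel the projected error contained in \<open>w n\<close>.\<close>
  have "(x n - w n + Qop L (a n + hadjoint L (b n)), y n - L (w n) + L (Qop L (a n + hadjoint L (b n))))
      = (-1/2) *\<^sub>R P (N (Z n) - Z n)" for n
  proof -
    have "(x n - w n + Qop L (a n + hadjoint L (b n)), y n - L (w n) + L (Qop L (a n + hadjoint L (b n))))
        = (x n, y n) - (w n, L (w n))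
          + (Qop L (a n + hadjoint L (b n)), L (Qop L (a n + hadjoint L (b n))))"
      by simp
    also have "\<dots> = (-1/2) *\<^sub>R P (N (Z n) - Z n)"
      unfolding PZ w Pe PNZ by (simp add: algebra_simps)
    finally show ?thesis .
  qed
  then have lim1: "(\<lambda>n. (x n - w n + Qop L (a n + hadjoint L (b n)),
      y n - L (w n) + L (Qop L (a n + hadjoint L (b n))))) \<longlonglongrightarrow> 0"
    using tendsto_scaleR[OF tendsto_const[of "-1/2"] Pres] by simp
  \<comment> \<open>Limit (ii) is the orthogonal component; all error terms cancel and
    \<open>J (Z n) - P (J (Z n))\<close> remains.\<close>
  have "(u n - r n + t n - a n + Qop L (a n + hadjoint L (b n)),
        v n - s n + L (t n) - b n + L (Qop L (a n + hadjoint L (b n))))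
      = (-1/2) *\<^sub>R ((N (Z n) - Z n) - P (N (Z n) - Z n))" for n
  proof -
    have "(u n - r n + t n - a n + Qop L (a n + hadjoint L (b n)),
          v n - s n + L (t n) - b n + L (Qop L (a n + hadjoint L (b n))))
        = (u n, v n) - (r n, s n) + (t n, L (t n)) - e n
          + (Qop L (a n + hadjoint L (b n)), L (Qop L (a n + hadjoint L (b n))))"
      by (simp add: e_def)
    also have "\<dots> = J (Z n) - P (J (Z n))"
      unfolding PZ' rs t Pe by simp
    also have "\<dots> = (-1/2) *\<^sub>R ((N (Z n) - Z n) - P (N (Z n) - Z n))"
    proof -
      have "(N (Z n) - Z n) - P (N (Z n) - Z n) = 2 *\<^sub>R (P (J (Z n)) - J (Z n))"
        unfolding PNZ unfolding NZ by (simp add: algebra_simps scaleR_2)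
      then show ?thesis by simp
    qed
    finally show ?thesis .
  qed
  then have lim2: "(\<lambda>n. (u n - r n + t n - a n + Qop L (a n + hadjoint L (b n)),
      v n - s n + L (t n) - b n + L (Qop L (a n + hadjoint L (b n))))) \<longlonglongrightarrow> 0"
    using tendsto_scaleR[OF tendsto_const[of "-1/2"] tendsto_diff[OF res Pres]] by simp
  obtain xb vb where sol: "\<zeta> = (xb - hadjoint L vb, L xb + vb)" "- hadjoint L vb \<in> A xb" "vb \<in> B (L xb)"
    using spingarn_op_fixed_pointE[OF L mmA mmB, of \<zeta>] \<zeta>(1) unfolding N_def by blast
  have P\<zeta>: "P \<zeta> = (xb, L xb)"
    unfolding sol(1) P_def by (rule graph_proj_eqI[OF L])
  have "weak_conv x xb"
    unfolding weak_conv_def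
  proof
    fix h
    \<comment> \<open>Self-adjointness of \<open>P\<close> turns a test of \<open>x n\<close>
      against \<open>h\<close> into a test of \<open>Z n\<close> against a fixed vector.\<close>
    have "(z \<bullet> P (h, 0)) = fst (P z) \<bullet> h" for z
      using graph_proj_selfadjoint[OF L, of z "(h, 0)"] by (cases "graph_proj L z") (simp add: P_def)
    moreover have "(\<lambda>n. Z n \<bullet> P (h, 0)) \<longlonglongrightarrow> \<zeta> \<bullet> P (h, 0)"
      using \<zeta>(2) unfolding weak_conv_def by blast
    ultimately show "(\<lambda>n. x n \<bullet> h) \<longlonglongrightarrow> xb \<bullet> h"
      by (simp add: PZ[symmetric] P\<zeta>)
  qed
  moreover have "weak_conv v vb"
    unfolding weak_conv_def
  proof
    fix h
    \<comment> \<open>The same device with the complementary projection, which extracts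
      \<open>v n\<close> from \<open>Z n\<close>.\<close>
    have "z \<bullet> ((0, h) - P (0, h)) = snd (z - P z) \<bullet> h" for z
      using graph_proj_selfadjoint[OF L, of z "(0, h)"]
      by (cases z; cases "graph_proj L z") (simp add: P_def inner_diff_left inner_diff_right)
    moreover have "(\<lambda>n. Z n \<bullet> ((0, h) - P (0, h))) \<longlonglongrightarrow> \<zeta> \<bullet> ((0, h) - P (0, h))"
      using \<zeta>(2) unfolding weak_conv_def by blast
    ultimately show "(\<lambda>n. v n \<bullet> h) \<longlonglongrightarrow> vb \<bullet> h"
      by (simp only: PZ'[symmetric] P\<zeta>) (simp add: sol(1))
  qed
  moreover have "primal_sol A B L xb"
    unfolding primal_sol_def using sol by force
  moreover have "dual_sol A B L vb"
    unfolding dual_sol_def op_inverse_def using sol by force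
  ultimately show ?thesis
    using tendsto_fst[OF lim1] tendsto_snd[OF lim1] tendsto_fst[OF lim2] tendsto_snd[OF lim2] sol
    by auto
qed

end
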